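(* Let $i\in\mathcal I$, $j\in\mathcal J$, $z_0\in\mathcal Z_0$, $p\in\mathcal P$ and $\mathcal S\in\overline{\mathcal S}_j(z_0)$. Let $A_j\in\mathbb R^{2\times n_p}$ be the matrix appearing in the zonotope reachable set $\xi_j(z_0,p)=\langle c_j(z_0)+A_jp,\;G_j\rangle$, and let $\mathrm{idx}(\mathcal S)\in\{-1,1\}$ be the triangle index of $\mathcal S$. Let $l_1>0$ and $l_2>0$ be the lengths of the horizontal and vertical right-angle sides (legs) of $\mathcal S$, respectively, and let $w^{\mathrm{ctr}}_{\mathcal S}$ be the right-angle vertex of $\mathcal S$. Let $$q_{i,j,\mathcal S}(w,p)=q_{i,j}(w^{\mathrm{ctr}}_{\mathcal S}+A_jp)+\frac{\partial q_{i,j}}{\partial w}(w^{\mathrm{ctr}}_{\mathcal S}+A_jp)\,(w-w^{\mathrm{ctr}}_{\mathcal S}-A_jp)+\tfrac12 (w-w^{\mathrm{ctr}}_{\mathcal S}-A_jp)^\top H_{\mathcal S}\,(w-w^{\mathrm{ctr}}_{\mathcal S}-A_jp).$$ Then $$\int_{\mathcal S+A_jp} q_{i,j,\mathcal S}(w,p)\,dw=\frac{1}{2\det(A_{\mathcal S})}\left(q_{i,j}(w^{\mathrm{ctr}}_{\mathcal S}+A_jp)+\begin{bmatrix}\frac{1}{4\sqrt3}&\frac1{4\sqrt3}\end{bmatrix}\left(\hat H_{\mathcal S}\odot\begin{bmatrix}2&1\\1&2\end{bmatrix}\right)\begin{bmatrix}\frac1{2\sqrt3}\\ \frac1{2\sqrt3}\end{bmatrix}+\frac{\partial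 q_{i,j}}{\partial w}(w^{\mathrm{ctr}}_{\mathcal S}+A_jp)\,A_{\mathcal S}^{-1}\begin{bmatrix}\frac13\\ \frac13\end{bmatrix}\right),$$ where $\odot$ denotes element-wise multiplication and $$A_{\mathcal S}=\begin{bmatrix}\mathrm{idx}(\mathcal S)/l_1&0\\0&\mathrm{idx}(\mathcal S)/l_2\end{bmatrix},\qquad \hat H_{\mathcal S}=A_{\mathcal S}^{-\top}H_{\mathcal S}A_{\mathcal S}^{-1}.$$
   Context: Zonotope notation: for $c\in\mathbb R^n$ and $G=[g_1,\dots,g_\ell]\in\mathbb R^{n\times\ell}$, $\langle c,\;G\rangle=\{c+\sum_{k=1}^\ell\beta_kg_k\mid\beta_k\in[-1,1]\}$. $\mathcal W\subset\mathbb R^2$ is the world space; all planar sets considered (including the translated triangles $\mathcal S+A_jp$, $p\in\mathcal P$) lie in $\mathcal W$. $\mathcal I$ (obstacles) and $\mathcal J$ (time intervals) are finite index sets, $\mathcal Z_0\subset\mathbb R^6$ is the set of initial conditions, $\mathcal P\subset\mathbb R^{n_p}$ is the set of trajectory parameters. For each $(i,j)\in\mathcal I\times\mathcal J$, $q_{i,j}:\mathcal W\to[0,\infty)$ is a twice-differentiable probability density function; $\frac{\partial q_{i,j}}{\partial w}$ is its gradient as a row vector. $G^{\mathrm{obs}}$ is a constant matrix with 2 rows. For each $j$, $\xi_j(z_0,p)=\langle c_j(z_0)+A_jp,\;G_j\rangle\subset\mathbb R^2$ with $c_j:\mathcal Z_0\to\mathbb R^2$ linear, $A_j\in\mathbb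 R^{2\times n_p}$, and $G_j$ a matrix with 2 rows. Triangles: for a fixed positive integer $k$, cover the zonotope $\langle c_j(z_0),\;[G_j,G^{\mathrm{obs}}]\rangle$ by an axis-aligned $k\times k$ grid of rectangular cells of equal size. Each cell (width $l_1$, height $l_2$) is cut along the diagonal joining its upper-left and lower-right corners into two right-angled triangles: the lower one, with index $1$, whose right-angle vertex is the lower-left corner of the cell, and the upper one, with index $-1$, whose right-angle vertex is the upper-right corner. $\overline{\mathcal S}_j(z_0)$ is the collection of those triangles having nonempty intersection with $\langle c_j(z_0),\;[G_j,G^{\mathrm{obs}}]\rangle$. $H_{\mathcal S}\in\mathbb R^{2\times2}$ is the matrix obtained by taking the element-wise supremum of the Hessian of $q_{i,j}$ over $\mathcal S\oplus A_j\mathcal P=\{s+A_jp'\mid s\in\mathcal S,\,p'\in\mathcal P\}$, computed by interval arithmetic (so each entry is a finite real number that is at least the supremum of the corresponding Hessian entry over that set); it does not depend on $w$ or $p$. *)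

theory Defs
  imports "HOL-Analysis.Analysis"
begin

(* A generator matrix is the list of its columns, so that its number of columns may depend
   on an index; [G, G'] is then G @ G'. *)

definition zonotope :: "'a::real_vector \<Rightarrow> 'a list \<Rightarrow> 'a set" where
  "zonotope c G =
     {c + (\<Sum>k<length G. \<beta> k *\<^sub>R (G ! k)) | \<beta>. \<forall>k<length G. \<beta> k \<in> {-1..1::real}}"

definition pdf_on :: "(real^2) set \<Rightarrow> (real^2 \<Rightarrow> real) \<Rightarrow> bool" where
  "pdf_on W f \<longleftrightarrow> (\<forall>w\<in>W. 0 \<le> f w) \<and> (f has_integral 1) W"

(* f is twice differentiable on W with gradient g and Hessian matrix K; derivatives are taken
   within W, which need not be open. *)

definition twice_differentiable_with ::
  "(real^2) set \<Rightarrow> (real^2 \<Rightarrow> real) \<Rightarrow> (real^2 \<Rightarrow> real^2) \<Rightarrow> (real^2 \<Rightarrow> real^2^2) \<Rightarrow> bool" where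
  "twice_differentiable_with W f g K \<longleftrightarrow>
     (\<forall>w\<in>W. (f has_derivative (\<lambda>h. g w \<bullet> h)) (at w within W) \<and>
            (g has_derivative (\<lambda>h. K w *v h)) (at w within W))"

(* The two halves of a rectangular cell cut along the diagonal from its upper-left to its
   lower-right corner. The corner stored is the lower-left one of the cell in both cases. *)

datatype triangle =
    Lower (corner: "real^2") (hleg: real) (vleg: real)
  | Upper (corner: "real^2") (hleg: real) (vleg: real)

fun region :: "triangle \<Rightarrow> (real^2) set" where
  "region (Lower v l1 l2) = convex hull {v, v + vector [l1, 0], v + vector [0, l2]}"
| "region (Upper v l1 l2) =
     convex hull {v + vector [l1, l2], v + vector [0, l2], v + vector [l1, 0]}"

fun idx :: "triangle \<Rightarrow> int" where
  "idx (Lower v l1 l2) = 1"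
| "idx (Upper v l1 l2) = -1"

fun right_angle_vertex :: "triangle \<Rightarrow> real^2" where
  "right_angle_vertex (Lower v l1 l2) = v"
| "right_angle_vertex (Upper v l1 l2) = v + vector [l1, l2]"

(* k x k grid with lower-left corner v and cells of width l1 and height l2. *)

definition grid_region :: "nat \<Rightarrow> real^2 \<Rightarrow> real \<Rightarrow> real \<Rightarrow> (real^2) set" where
  "grid_region k v l1 l2 = cbox v (v + vector [real k * l1, real k * l2])"

definition grid_triangles :: "nat \<Rightarrow> real^2 \<Rightarrow> real \<Rightarrow> real \<Rightarrow> triangle set" where
  "grid_triangles k v l1 l2 =
     (\<Union>a<k. \<Union>b<k.
        {Lower (v + vector [real a * l1, real b * l2]) l1 l2,
         Upper (v + vector [real a * l1, real b * l2]) l1 l2})"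

definition meeting_triangles ::
  "nat \<Rightarrow> real^2 \<Rightarrow> real \<Rightarrow> real \<Rightarrow> (real^2) set \<Rightarrow> triangle set" where
  "meeting_triangles k v l1 l2 Z = {S \<in> grid_triangles k v l1 l2. region S \<inter> Z \<noteq> {}}"

(* The function q_{i,j,S}(w,p), with d = A_j p; g is the gradient of f and H the matrix H_S. *)

definition quadratic_model ::
  "(real^2 \<Rightarrow> real) \<Rightarrow> (real^2 \<Rightarrow> real^2) \<Rightarrow> real^2^2 \<Rightarrow> triangle \<Rightarrow> real^2 \<Rightarrow> real^2 \<Rightarrow> real" where
  "quadratic_model f g H S d w =
     (let ctr = right_angle_vertex S in
        f (ctr + d) + g (ctr + d) \<bullet> (w - ctr - d)
        + 1/2 * ((w - ctr - d) \<bullet> (H *v (w - ctr - d))))"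

definition A_mat :: "triangle \<Rightarrow> real^2^2" where
  "A_mat S = vector [vector [of_int (idx S) / hleg S, 0],
                     vector [0, of_int (idx S) / vleg S]]"

definition H_hat :: "real^2^2 \<Rightarrow> triangle \<Rightarrow> real^2^2" where
  "H_hat H S = transpose (matrix_inv (A_mat S)) ** H ** matrix_inv (A_mat S)"

definition hadamard :: "real^'n^'m \<Rightarrow> real^'n^'m \<Rightarrow> real^'n^'m" where
  "hadamard M N = (\<chi> a b. M $ a $ b * N $ a $ b)"

end

theory Submission
  imports Defs
begin

text \<open>
  The triangle \<open>S + A\<^sub>j p\<close> is the image of the unit triangle under the map \<open>u \<mapsto> ctr + A\<^sub>j p + A\<^sub>S\<inverse> u\<close>,
  which is axis-parallel and negates both axes for upper triangles. In the coordinates \<open>u\<close> the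
  integrand is a quadratic polynomial, and the unit triangle has area \<open>1/2\<close>, first moments \<open>1/6\<close>
  and second moments \<open>1/12\<close> (squares) and \<open>1/24\<close> (mixed); the Jacobian is \<open>l1 l2 = 1 / det A\<^sub>S\<close>.
\<close>

text \<open>Fubini reduces this to an inner integral over \<open>y\<close> in
  \<open>{0..1-x}\<close> and an outer one over \<open>x\<close> in \<open>{0..1}\<close>, each
  evaluated from an explicit antiderivative.\<close>

lemma has_integral_quadratic_unit_triangle:
  fixes a b1 b2 c11 c12 c22 :: real
  shows "((\<lambda>(x, y). a + b1 * x + b2 * y + c11 * x\<^sup>2 + c12 * x * y + c22 * y\<^sup>2) has_integral
     a / 2 + b1 / 6 + b2 / 6 + c11 / 12 + c12 / 24 + c22 / 12)
     {(x, y). 0 \<le> x \<and> 0 \<le> y \<and> x + y \<le> 1}"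
    (is "(?f has_integral ?I) ?T")
proof -
  have T: "?T = {z. 0 \<le> fst z} \<inter> {z. 0 \<le> snd z} \<inter> {z. fst z + snd z \<le> 1}" by auto
  \<comment> \<open>Continuity on a compact set gives Lebesgue integrability, needed both for Fubini
    and for passing back to the gauge integral.\<close>
  have "closed ?T" unfolding T
    by (intro closed_Int closed_Collect_le continuous_intros)
  moreover have "bounded ?T"
    by (rule bounded_subset[OF bounded_cbox[of "(0,0)" "(1,1)"]]) (auto simp: cbox_Pair_eq)
  ultimately have "compact ?T" by (simp add: compact_eq_bounded_closed)
  moreover have "continuous_on ?T ?f"
    unfolding case_prod_beta by (intro continuous_intros)
  ultimately have int: "integrable lborel (\<lambda>z. indicator ?T z *\<^sub>R ?f z)"
    by (rule borel_integrable_compact)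
  \<comment> \<open>\<open>F x\<close> is the antiderivative in \<open>y\<close> of the integrand
    that vanishes at \<open>0\<close>, so the slice over \<open>x\<close> integrates to
    \<open>E x\<close>.\<close>
  define F where "F x y = (a + b1 * x + c11 * x\<^sup>2) * y + (b2 + c12 * x) * y\<^sup>2 / 2 + c22 * y^3 / 3" for x y
  define E where "E x = F x (1 - x)" for x
  have inner: "(\<integral>y. indicator ?T (x, y) *\<^sub>R ?f (x, y) \<partial>lborel) = indicator {0..1} x *\<^sub>R E x" for x
  proof (cases "x \<in> {0..1}")
    case True
    have "(\<integral>y. indicator ?T (x, y) *\<^sub>R ?f (x, y) \<partial>lborel)
        = (\<integral>y. indicator {0..1-x} y *\<^sub>R (a + b1 * x + b2 * y + c11 * x\<^sup>2 + c12 * x * y + c22 * y\<^sup>2) \<partial>lborel)"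
      using True by (intro Bochner_Integration.integral_cong) (auto simp: indicator_def)
    also have "\<dots> = F x (1 - x) - F x 0"
      unfolding F_def using True
      by (intro integral_FTC_atLeastAtMost)
         (auto intro!: derivative_eq_intros continuous_intros
               simp flip: has_real_derivative_iff_has_vector_derivative
               simp: algebra_simps power2_eq_square)
    finally show ?thesis using True by (simp add: E_def F_def)
  next
    case False
    then have "indicator ?T (x, y) = (0::real)" for y by (auto simp: indicator_def)
    with False show ?thesis by simp
  qed
  \<comment> \<open>An antiderivative of \<open>E\<close>. The \<open>b2\<close> and
    \<open>c22\<close> terms stay in powers of \<open>1 - x\<close>, the form in which
    \<open>E\<close> contains them.\<close>
  define D where "D x = a * (x - x\<^sup>2 / 2) + b1 * (x\<^sup>2 / 2 - x^3 / 3) + c11 * (x^3 / 3 - x^4 / 4)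
     - b2 * (1 - x)^3 / 6 + c12 * (x\<^sup>2 / 2 - 2 * x^3 / 3 + x^4 / 4) / 2 - c22 * (1 - x)^4 / 12" for x
  have "(\<integral>z. indicator ?T z *\<^sub>R ?f z \<partial>lborel) = (\<integral>x. indicator {0..1} x *\<^sub>R E x \<partial>lborel)"
    using lborel_pair.integral_fst'[of "\<lambda>z. indicator ?T z *\<^sub>R ?f z"] int
    unfolding lborel_prod inner by simp
  also have "\<dots> = D 1 - D 0"
    unfolding D_def E_def F_def
    by (intro integral_FTC_atLeastAtMost)
       (auto intro!: derivative_eq_intros continuous_intros
             simp flip: has_real_derivative_iff_has_vector_derivative
             simp: field_simps power2_eq_square power3_eq_cube)
  also have "\<dots> = ?I" by (simp add: D_def field_simps)
  finally have "((\<lambda>z. indicator ?T z *\<^sub>R ?f z) has_integral ?I) UNIV"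
    using has_integral_integral_lborel[OF int] by simp
  also have "(\<lambda>z. indicator ?T z *\<^sub>R ?f z) = (\<lambda>z. if z \<in> ?T then ?f z else 0)"
    by (auto simp: indicator_def)
  finally show ?thesis by (simp only: has_integral_restrict_UNIV)
qed

text \<open>The substitution crosses from \<open>real \<times> real\<close> to
  \<open>real^2\<close>. It rests on \<open>has_integral_twiddle\<close>, which asks for mutually
  inverse maps that send boxes to boxes, the continuous one scaling content by a constant. The
  factors may be negative, as upper triangles require, hence the absolute value.\<close>

lemma has_integral_axis_affine:
  fixes f :: "real \<times> real \<Rightarrow> 'a::banach" and c :: "real^2"
  assumes f: "(f has_integral I) T" and "bounded T" and m: "m1 \<noteq> 0" "m2 \<noteq> 0"
  shows "((\<lambda>w. f ((w$1 - c$1) / m1, (w$2 - c$2) / m2)) has_integral \<bar>m1 * m2\<bar> *\<^sub>R I)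
           ((\<lambda>(x, y). c + vector [m1 * x, m2 * y]) ` T)"
proof -
  define g where "g w = ((w$1 - c$1) / m1, (w$2 - c$2) / m2)" for w :: "real^2"
  define h where "h = (\<lambda>(x, y). c + vector [m1 * x, m2 * y])"
  have hg: "h (g w) = w" for w
    using m by (auto simp: h_def g_def vec_eq_iff forall_2)
  have gh: "g (h z) = z" for z
    using m by (cases z) (auto simp: h_def g_def)
  have cbox2: "x \<in> cbox u v \<longleftrightarrow> x$1 \<in> cbox (u$1) (v$1) \<and> x$2 \<in> cbox (u$2) (v$2)" for x u v :: "real^2"
    by (auto simp: mem_box_cart forall_2)
  \<comment> \<open>Since the map is axis-parallel, images of boxes are products of one-dimensional
    affine images. This reduces both the box property and the content to intervals.\<close>
  have g_img: "g ` cbox u v = (\<lambda>x. (1/m1) *\<^sub>R x + - (c$1/m1)) ` cbox (u$1) (v$1)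
                  \<times> (\<lambda>x. (1/m2) *\<^sub>R x + - (c$2/m2)) ` cbox (u$2) (v$2)" (is "_ = ?R") for u v
  proof (intro equalityI subsetI)
    fix z assume "z \<in> ?R"
    then obtain x y where "x \<in> cbox (u$1) (v$1)" "y \<in> cbox (u$2) (v$2)"
      and "z = ((1/m1) *\<^sub>R x + - (c$1/m1), (1/m2) *\<^sub>R y + - (c$2/m2))" by auto
    then show "z \<in> g ` cbox u v"
      by (intro image_eqI[of _ _ "vector [x, y]"]) (auto simp: g_def cbox2 diff_divide_distrib)
  qed (auto simp: g_def cbox2 diff_divide_distrib intro!: image_eqI)
  have h_img: "h ` (cbox u1 v1 \<times> cbox u2 v2) = 
      {w. w$1 \<in> (\<lambda>x. m1 *\<^sub>R x + c$1) ` cbox u1 v1 \<and> w$2 \<in> (\<lambda>x. m2 *\<^sub>R x + c$2) ` cbox u2 v2}"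
    for u1 v1 u2 v2
  proof (intro equalityI subsetI)
    fix w :: "real^2" assume "w \<in> {w. w$1 \<in> (\<lambda>x. m1 *\<^sub>R x + c$1) ` cbox u1 v1 \<and> w$2 \<in> (\<lambda>x. m2 *\<^sub>R x + c$2) ` cbox u2 v2}"
    then obtain x y where "x \<in> cbox u1 v1" "y \<in> cbox u2 v2" "w$1 = m1 *\<^sub>R x + c$1" "w$2 = m2 *\<^sub>R y + c$2"
      by auto
    then show "w \<in> h ` (cbox u1 v1 \<times> cbox u2 v2)"
      by (intro image_eqI[of _ _ "(x, y)"]) (auto simp: h_def vec_eq_iff forall_2)
  qed (auto simp: h_def)
  \<comment> \<open>A negative \<open>m\<close> swaps the endpoints, and an empty interval must
    itself be presented as a \<open>cbox\<close>.\<close>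
  have aff: "\<exists>w z. (\<lambda>x. m *\<^sub>R x + c) ` cbox u v = cbox w z" for m c u v :: real
    unfolding image_affinity_cbox using empty_as_interval by auto
  have g_box: "\<exists>w z. g ` cbox u v = cbox w z" for u v
  proof -
    obtain p q r s where "(\<lambda>x. (1/m1) *\<^sub>R x + - (c$1/m1)) ` cbox (u$1) (v$1) = cbox p q"
       "(\<lambda>x. (1/m2) *\<^sub>R x + - (c$2/m2)) ` cbox (u$2) (v$2) = cbox r s"
        using aff[of "1/m1" "- (c$1/m1)" "u$1" "v$1"]
          aff[of "1/m2" "- (c$2/m2)" "u$2" "v$2"] by blast
    then show ?thesis unfolding g_img by (metis cbox_Pair_eq)
  qed
  have h_box: "\<exists>w z. h ` cbox u v = cbox w z" for u v
  proof -
    obtain u1 u2 v1 v2 where uv: "u = (u1, u2)" "v = (v1, v2)" by (metis surj_pair)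
    obtain p1 q1 p2 q2 where "(\<lambda>x. m1 *\<^sub>R x + c$1) ` cbox u1 v1 = cbox p1 q1"
       "(\<lambda>x. m2 *\<^sub>R x + c$2) ` cbox u2 v2 = cbox p2 q2"
        using aff[of m1 "c$1" u1 v1] aff[of m2 "c$2" u2 v2] by blast
    then have "h ` cbox u v = cbox (vector [p1, p2]) (vector [q1, q2])"
      unfolding uv cbox_Pair_eq h_img by (auto simp: cbox2)
    then show ?thesis by blast
  qed
  have content_aff: "measure lborel ((\<lambda>x. m *\<^sub>R x + c) ` cbox u v) = \<bar>m\<bar> * measure lborel (cbox u v)" for m c u v :: real
    using content_image_affinity_cbox[of m c u v] by simp
  have content_times: "measure lborel (A \<times> B) = measure lborel A * measure lborel B"
    if "A = cbox p q" "B = cbox r s" for A B :: "real set" and p q r s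
    using content_Pair[of p r q s] that by (simp add: cbox_Pair_eq)
  have content_g: "measure lborel (g ` cbox u v) = 1 / \<bar>m1 * m2\<bar> * measure lborel (cbox u v)" for u v
  proof -
    have "measure lborel (g ` cbox u v) = (\<bar>1/m1\<bar> * measure lborel (cbox (u$1) (v$1))) * (\<bar>1/m2\<bar> * measure lborel (cbox (u$2) (v$2)))"
    proof -
      let ?A1 = "(\<lambda>x. (1/m1) *\<^sub>R x + - (c$1/m1)) ` cbox (u$1) (v$1)"
      let ?A2 = "(\<lambda>x. (1/m2) *\<^sub>R x + - (c$2/m2)) ` cbox (u$2) (v$2)"
      obtain p q r s where "?A1 = cbox p q" "?A2 = cbox r s"
        using aff[of "1/m1" "- (c$1/m1)" "u$1" "v$1"]
          aff[of "1/m2" "- (c$2/m2)" "u$2" "v$2"] by blast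
      then have "measure lborel (?A1 \<times> ?A2) = measure lborel ?A1 * measure lborel ?A2" by (rule content_times)
      then show ?thesis unfolding g_img content_aff .
    qed
    moreover have "measure lborel (cbox u v) = measure lborel (cbox (u$1) (v$1)) * measure lborel (cbox (u$2) (v$2))"
    proof -
      \<comment> \<open>The content formula for \<open>real^2\<close> branches on emptiness of the
        box; a box is empty exactly when one side is, and then both contents are zero.\<close>
      have "cbox u v = {} \<longleftrightarrow> v$1 < u$1 \<or> v$2 < u$2"
        unfolding interval_eq_empty_cart(2) using forall_2[of "\<lambda>i. \<not> v$i < u$i"] by blast
      then show ?thesis
        by (auto simp: content_cbox_if_cart UNIV_2 content_real_if)
    qed
    ultimately show ?thesis by (simp add: abs_mult)
  qed
  \<comment> \<open>\<open>has_integral_twiddle\<close> works over a box, so \<open>f\<close> is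
    extended by zero from \<open>T\<close> to a box around it.\<close>
  obtain a b where ab: "T \<subseteq> cbox a b"
    using \<open>bounded T\<close> bounded_subset_cbox_symmetric by blast
  have on_box: "((\<lambda>z. if z \<in> T then f z else 0) has_integral I) (cbox a b)"
    using f ab by (simp add: has_integral_restrict)
  have "0 < 1 / \<bar>m1 * m2\<bar>" using m by simp
  moreover have "continuous (at w) g" for w
    unfolding g_def using m by (intro continuous_intros) auto
  \<comment> \<open>\<open>g\<close> contracts content by \<open>1 / \<bar>m1 * m2\<bar>\<close>,
    and the rule divides by this factor.\<close>
  ultimately have "((\<lambda>w. if g w \<in> T then f (g w) else 0) has_integral (1 / (1 / \<bar>m1 * m2\<bar>)) *\<^sub>R I) (h ` cbox a b)"
    by (rule has_integral_twiddle[where f = "\<lambda>z. if z \<in> T then f z else 0" and g = g and h = h,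
          OF _ hg gh _ g_box h_box content_g on_box])
  moreover have "g w \<in> T \<longleftrightarrow> w \<in> h ` T" for w
    using gh hg by (auto simp: image_iff) metis
  ultimately show ?thesis
    using ab by (simp add: has_integral_restrict image_mono flip: g_def h_def)
qed

text \<open>The sign \<open>idx S\<close> is its own inverse, so it stays in the numerator when the
  diagonal entries are inverted.\<close>

lemma matrix_inv_A_mat:
  assumes "hleg S \<noteq> 0" "vleg S \<noteq> 0"
  shows "matrix_inv (A_mat S) = vector [vector [of_int (idx S) * hleg S, 0], vector [0, of_int (idx S) * vleg S]]"
    (is "_ = ?B")
proof -
  have "A_mat S ** ?B = mat 1" and BA: "?B ** A_mat S = mat 1"
    using assms by (cases S; simp add: A_mat_def matrix_matrix_mult_def vec_eq_iff forall_2 sum_2 mat_def)+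
  then have "invertible (A_mat S)" unfolding invertible_def by blast
  \<comment> \<open>\<open>matrix_inv\<close> is a choice among two-sided inverses: existence yields
    its defining property, and multiplying by \<open>?B\<close> on the left identifies it.\<close>
  then have "A_mat S ** matrix_inv (A_mat S) = mat 1"
    unfolding invertible_def matrix_inv_def by (rule someI2_ex) simp
  then show ?thesis
    using matrix_mul_assoc[of ?B "A_mat S" "matrix_inv (A_mat S)"] BA by simp
qed

text \<open>Seen from the right-angle vertex, the legs point along \<open>idx S\<close> times the
  coordinate axes, so both kinds of triangle share one parametrization by barycentric
  coordinates.\<close>

lemma translated_region_eq:
  "(\<lambda>s. s + d) ` region S =
     (\<lambda>(x, y). (right_angle_vertex S + d) + vector [of_int (idx S) * hleg S * x, of_int (idx S) * vleg S * y])
       ` {(x, y). 0 \<le> x \<and> 0 \<le> y \<and> x + y \<le> 1}"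
proof -
  let ?a = "right_angle_vertex S"
  let ?b = "?a + vector [of_int (idx S) * hleg S, 0]"
  let ?c = "?a + vector [0, of_int (idx S) * vleg S]"
  \<comment> \<open>For an upper triangle, walking back along a leg from the upper-right corner
    reaches the ends of the diagonal, the vertices listed in \<open>region\<close>.\<close>
  have eq: "v + vector [l1, l2] + vector [- l1, 0] = v + vector [0, l2]"
     "v + vector [l1, l2] + vector [0, - l2] = v + vector [l1, 0]" for v :: "real^2" and l1 l2
    by (simp_all add: vec_eq_iff forall_2)
  have "region S = convex hull {?a, ?b, ?c}"
    by (cases S) (simp_all add: eq)
  also have "\<dots> = (\<lambda>(x, y). ?a + x *\<^sub>R (?b - ?a) + y *\<^sub>R (?c - ?a))
       ` {(x, y). 0 \<le> x \<and> 0 \<le> y \<and> x + y \<le> 1}"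
    unfolding convex_hull_3_alt by auto
  finally have "(\<lambda>s. s + d) ` region S = (\<lambda>z. (case z of (x, y) \<Rightarrow> ?a + x *\<^sub>R (?b - ?a) + y *\<^sub>R (?c - ?a)) + d)
       ` {(x, y). 0 \<le> x \<and> 0 \<le> y \<and> x + y \<le> 1}"
    by (simp only: image_image)
  also have "\<dots> = (\<lambda>(x, y). (?a + d) + vector [of_int (idx S) * hleg S * x, of_int (idx S) * vleg S * y])
       ` {(x, y). 0 \<le> x \<and> 0 \<le> y \<and> x + y \<le> 1}"
    by (rule image_cong) (auto simp: vec_eq_iff forall_2)
  finally show ?thesis .
qed

text \<open>In unit-triangle coordinates the model is a polynomial, integrated by the moment
  formula. The vector of entries \<open>1/3\<close> is the centroid of the unit triangle; the
  weights \<open>2\<close> and \<open>1\<close> reflect the ratio of the second moments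
  \<open>1/12\<close> and \<open>1/24\<close>.\<close>

lemma has_integral_quadratic_model:
  fixes f :: "real^2 \<Rightarrow> real"
  assumes pos: "hleg S > 0" "vleg S > 0"
  shows "(quadratic_model f g H S d has_integral
           1 / (2 * det (A_mat S)) *
           (f (right_angle_vertex S + d)
            + vector [1 / (4 * sqrt 3), 1 / (4 * sqrt 3)] \<bullet>
                (hadamard (H_hat H S) (vector [vector [2, 1], vector [1, 2]])
                  *v vector [1 / (2 * sqrt 3), 1 / (2 * sqrt 3)])
            + g (right_angle_vertex S + d) \<bullet> (matrix_inv (A_mat S) *v vector [1/3, 1/3])))
         ((\<lambda>s. s + d) ` region S)"
proof -
  define e :: real where "e = of_int (idx S)"
  define l1 where "l1 = hleg S"
  define l2 where "l2 = vleg S"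
  define c where "c = right_angle_vertex S + d"
  define T where "T = {(x::real, y::real). 0 \<le> x \<and> 0 \<le> y \<and> x + y \<le> 1}"
  have ee: "e * e = 1" by (cases S) (auto simp: e_def)
  then have e0: "e \<noteq> 0" by auto
  have l: "l1 > 0" "l2 > 0" using pos by (auto simp: l1_def l2_def)
  have T_bd: "bounded T"
    by (rule bounded_subset[OF bounded_cbox[of "(0,0)" "(1,1)"]]) (auto simp: T_def cbox_Pair_eq)
  have inv: "matrix_inv (A_mat S) = vector [vector [e * l1, 0], vector [0, e * l2]]"
    using matrix_inv_A_mat[of S] pos by (simp add: e_def l1_def l2_def)
  have det: "det (A_mat S) = 1 / (l1 * l2)"
    using ee l by (simp add: det_2 A_mat_def e_def l1_def l2_def)
  \<comment> \<open>Obtained from \<open>w - c = (e * l1 * x, e * l2 * y)\<close>. The sign survives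
    only in the linear terms because \<open>e * e = 1\<close>; the mixed term collects both
    off-diagonal entries of \<open>H\<close>.\<close>
  let ?p = "\<lambda>(x, y). f c + e * l1 * g c $ 1 * x + e * l2 * g c $ 2 * y
      + l1\<^sup>2 * H $ 1 $ 1 / 2 * x\<^sup>2 + l1 * l2 * (H $ 1 $ 2 + H $ 2 $ 1) / 2 * x * y + l2\<^sup>2 * H $ 2 $ 2 / 2 * y\<^sup>2"
  let ?I = "f c / 2 + e * l1 * g c $ 1 / 6 + e * l2 * g c $ 2 / 6
      + (l1\<^sup>2 * H $ 1 $ 1 / 2) / 12 + (l1 * l2 * (H $ 1 $ 2 + H $ 2 $ 1) / 2) / 24 + (l2\<^sup>2 * H $ 2 $ 2 / 2) / 12"
  have "(?p has_integral ?I) T"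
    unfolding T_def by (rule has_integral_quadratic_unit_triangle)
  from has_integral_axis_affine[OF this T_bd, of "e * l1" "e * l2" c]
  have main: "((\<lambda>w. ?p ((w$1 - c$1) / (e * l1), (w$2 - c$2) / (e * l2)))
      has_integral \<bar>e * l1 * (e * l2)\<bar> *\<^sub>R ?I) ((\<lambda>s. s + d) ` region S)"
    unfolding translated_region_eq T_def using e0 l by (simp add: c_def e_def l1_def l2_def)
  have "\<bar>e * l1 * (e * l2)\<bar> *\<^sub>R ?I = 1 / (2 * det (A_mat S)) *
           (f c
            + vector [1 / (4 * sqrt 3), 1 / (4 * sqrt 3)] \<bullet>
                (hadamard (H_hat H S) (vector [vector [2, 1], vector [1, 2]])
                  *v vector [1 / (2 * sqrt 3), 1 / (2 * sqrt 3)])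
            + g c \<bullet> (matrix_inv (A_mat S) *v vector [1/3, 1/3]))" (is "_ = ?J")
  proof -
    have "\<bar>e\<bar> = 1" by (cases S) (auto simp: e_def)
    then have 1: "\<bar>e * l1 * (e * l2)\<bar> = l1 * l2" using l by (simp add: abs_mult)
    have H_hat: "H_hat H S = vector [vector [l1\<^sup>2 * H$1$1, l1 * l2 * H$1$2], vector [l1 * l2 * H$2$1, l2\<^sup>2 * H$2$2]]"
      unfolding H_hat_def inv
      by (simp add: matrix_matrix_mult_def transpose_def vec_eq_iff forall_2 sum_2 power2_eq_square)
         (use ee in algebra)
    \<comment> \<open>Vectors with equal entries merely sum the entries of the matrix between them,
      and the two square roots combine to the rational factor \<open>1 / 24\<close>.\<close>
    have "vector [a, a] \<bullet> (M *v vector [b, b]) = a * b * (M$1$1 + M$1$2 + M$2$1 + M$2$2)"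
      for M :: "real^2^2" and a b
      by (simp add: inner_vec_def matrix_vector_mult_def sum_2 algebra_simps)
    moreover have "1 / (4 * sqrt 3) * (1 / (2 * sqrt 3)) = 1 / (24::real)"
      by simp
    ultimately have quad: "vector [1 / (4 * sqrt 3), 1 / (4 * sqrt 3)] \<bullet> (M *v vector [1 / (2 * sqrt 3), 1 / (2 * sqrt 3)])
        = 1 / 24 * (M$1$1 + M$1$2 + M$2$1 + M$2$2)" for M :: "real^2^2"
      by presburger
    show ?thesis
      unfolding 1 det H_hat inv quad
      using l by (simp add: hadamard_def inner_vec_def matrix_vector_mult_def sum_2 field_simps power2_eq_square)
  qed
  moreover have "?p ((w$1 - c$1) / (e * l1), (w$2 - c$2) / (e * l2)) = quadratic_model f g H S d w" for w
  proof -
    define x where "x = (w$1 - c$1) / (e * l1)"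
    define y where "y = (w$2 - c$2) / (e * l2)"
    \<comment> \<open>\<open>x\<close> and \<open>y\<close> invert the parametrization, so the
      pulled-back polynomial agrees with the model at every \<open>w\<close>, not just on the
      triangle.\<close>
    have w: "w - right_angle_vertex S - d = vector [e * l1 * x, e * l2 * y]"
      using e0 l by (simp add: x_def y_def c_def vec_eq_iff forall_2)
    show ?thesis
      unfolding quadratic_model_def Let_def w c_def[symmetric] x_def[symmetric] y_def[symmetric]
      by (simp add: inner_vec_def matrix_vector_mult_def sum_2 power2_eq_square)
         (use ee in algebra)
  qed
  ultimately show ?thesis
    using main by (simp add: c_def)
qed

theorem theorem13:
  fixes I :: "'i set" and J :: "'j set"
    and W :: "(real^2) set" and Z0 :: "(real^6) set" and P :: "(real^'n) set"
    and q :: "'i \<Rightarrow> 'j \<Rightarrow> real^2 \<Rightarrow> real"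
    and dq :: "'i \<Rightarrow> 'j \<Rightarrow> real^2 \<Rightarrow> real^2"
    and Hess :: "'i \<Rightarrow> 'j \<Rightarrow> real^2 \<Rightarrow> real^2^2"
    and c :: "'j \<Rightarrow> real^6 \<Rightarrow> real^2" and A :: "'j \<Rightarrow> real^'n^2"
    and G :: "'j \<Rightarrow> (real^2) list" and Gobs :: "(real^2) list"
    and \<xi> :: "'j \<Rightarrow> real^6 \<Rightarrow> real^'n \<Rightarrow> (real^2) set"
    and Zbuf :: "'j \<Rightarrow> real^6 \<Rightarrow> (real^2) set"
    and k :: nat
    and origin :: "'j \<Rightarrow> real^6 \<Rightarrow> real^2"
    and width height :: "'j \<Rightarrow> real^6 \<Rightarrow> real"
    and Sbar :: "'j \<Rightarrow> real^6 \<Rightarrow> triangle set"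
    and H :: "'i \<Rightarrow> 'j \<Rightarrow> triangle \<Rightarrow> real^2^2"
    and i :: 'i and j :: 'j and z0 :: "real^6" and p :: "real^'n" and S :: triangle
  assumes "finite I" and "finite J"
    and "\<And>i j. i \<in> I \<Longrightarrow> j \<in> J \<Longrightarrow> pdf_on W (q i j)"
    and "\<And>i j. i \<in> I \<Longrightarrow> j \<in> J \<Longrightarrow> twice_differentiable_with W (q i j) (dq i j) (Hess i j)"
    and "\<And>j. j \<in> J \<Longrightarrow> linear (c j)"
    and "\<And>j z0 p. \<xi> j z0 p = zonotope (c j z0 + A j *v p) (G j)"
    and "\<And>j z0. Zbuf j z0 = zonotope (c j z0) (G j @ Gobs)"
    and "k > 0"
    and "\<And>j z0. j \<in> J \<Longrightarrow> z0 \<in> Z0 \<Longrightarrow>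
           Zbuf j z0 \<subseteq> grid_region k (origin j z0) (width j z0) (height j z0)"
    and "\<And>j z0. Sbar j z0 =
           meeting_triangles k (origin j z0) (width j z0) (height j z0) (Zbuf j z0)"
    and "\<And>j z0. j \<in> J \<Longrightarrow> z0 \<in> Z0 \<Longrightarrow> Zbuf j z0 \<subseteq> W"
    and "\<And>j z0 p. j \<in> J \<Longrightarrow> z0 \<in> Z0 \<Longrightarrow> p \<in> P \<Longrightarrow> \<xi> j z0 p \<subseteq> W"
    and "\<And>j z0 S. j \<in> J \<Longrightarrow> z0 \<in> Z0 \<Longrightarrow> S \<in> Sbar j z0 \<Longrightarrow> region S \<subseteq> W"
    and "\<And>j z0 S p. j \<in> J \<Longrightarrow> z0 \<in> Z0 \<Longrightarrow> S \<in> Sbar j z0 \<Longrightarrow> p \<in> P \<Longrightarrow>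
           (\<lambda>s. s + A j *v p) ` region S \<subseteq> W"
    and "\<And>i j z0 S x a b. i \<in> I \<Longrightarrow> j \<in> J \<Longrightarrow> z0 \<in> Z0 \<Longrightarrow> S \<in> Sbar j z0 \<Longrightarrow>
           x \<in> {s + A j *v p' | s p'. s \<in> region S \<and> p' \<in> P} \<Longrightarrow>
           Hess i j x $ a $ b \<le> H i j S $ a $ b"
    and "i \<in> I" and "j \<in> J" and "z0 \<in> Z0" and "p \<in> P" and "S \<in> Sbar j z0"
    and "hleg S > 0" and "vleg S > 0"
  shows "(quadratic_model (q i j) (dq i j) (H i j S) S (A j *v p) has_integral
           1 / (2 * det (A_mat S)) *
           (q i j (right_angle_vertex S + A j *v p)
            + vector [1 / (4 * sqrt 3), 1 / (4 * sqrt 3)] \<bullet>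
                (hadamard (H_hat (H i j S) S) (vector [vector [2, 1], vector [1, 2]])
                  *v vector [1 / (2 * sqrt 3), 1 / (2 * sqrt 3)])
            + dq i j (right_angle_vertex S + A j *v p) \<bullet>
                (matrix_inv (A_mat S) *v vector [1/3, 1/3])))
         ((\<lambda>s. s + A j *v p) ` region S)"
  using \<open>hleg S > 0\<close> \<open>vleg S > 0\<close> by (rule has_integral_quadratic_model)

end
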